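(* Let $G$ be a $2$-connected graph and let $v,w$ be two distinct vertices of $G$. Then either (i) there exists an EPS-graph $S=E\cup P\subseteq G$ with $d_P(v)=0=d_P(w)$; or (ii) there exists a JEPS-graph $S=J\cup E\cup P\subseteq G$ such that $v$ and $w$ are the only odd-degree vertices of $J$, and $d_P(v)=0=d_P(w)$.
   Context: Graphs are finite and loopless; multiple edges are allowed. A graph is called eulerian if all its vertices have even degree (it need not be connected; the empty graph is allowed). A linear forest is a graph each of whose components is a path. An EPS-graph of $G$ is a spanning connected subgraph $S$ of $G$ which is the edge-disjoint union of an eulerian graph $E$ and a linear forest $P$; we write $S=E\cup P$. A JEPS-graph of $G$ is a spanning connected subgraph $S$ of $G$ which is the edge-disjoint union of an open trail $J$, an eulerian graph $E$ and a linear forest $P$; we write $S=J\cup E\cup P$. For a vertex $u$, $d_P(u)$ denotes the degree of $u$ in $P$ (taken to be $0$ if $u$ is not incident with an edge of $P$). *)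

theory Defs
  imports Main
begin

text \<open>
  Undirected multigraphs: parallel edges are distinct elements of \<^typ>\<open>'e\<close> with the same set of
  end vertices. Values of \<open>ends\<close> outside \<open>edges\<close> are irrelevant.
\<close>

record ('v, 'e) mgraph =
  verts :: "'v set"
  edges :: "'e set"
  ends :: "'e \<Rightarrow> 'v set"

text \<open>
  The condition \<open>card (ends G e) = 2\<close> excludes loops. The null graph is a graph.
\<close>

definition graph :: "('v, 'e) mgraph \<Rightarrow> bool" where
  "graph G \<longleftrightarrow> finite (verts G) \<and> finite (edges G) \<and>
     (\<forall>e\<in>edges G. ends G e \<subseteq> verts G \<and> card (ends G e) = 2)"

definition subgraph :: "('v, 'e) mgraph \<Rightarrow> ('v, 'e) mgraph \<Rightarrow> bool" where
  "subgraph H G \<longleftrightarrow> graph H \<and> graph G \<and> verts H \<subseteq> verts G \<and> edges H \<subseteq> edges G \<and>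
     (\<forall>e\<in>edges H. ends H e = ends G e)"

definition degree :: "('v, 'e) mgraph \<Rightarrow> 'v \<Rightarrow> nat" where
  "degree G x = card {e \<in> edges G. x \<in> ends G e}"

definition walk :: "('v, 'e) mgraph \<Rightarrow> 'v list \<Rightarrow> 'e list \<Rightarrow> bool" where
  "walk G vs es \<longleftrightarrow> length vs = Suc (length es) \<and> set vs \<subseteq> verts G \<and> set es \<subseteq> edges G \<and>
     (\<forall>i<length es. ends G (es ! i) = {vs ! i, vs ! Suc i})"

definition connected :: "('v, 'e) mgraph \<Rightarrow> bool" where
  "connected G \<longleftrightarrow> graph G \<and> verts G \<noteq> {} \<and>
     (\<forall>u\<in>verts G. \<forall>w\<in>verts G. \<exists>vs es. walk G vs es \<and> hd vs = u \<and> last vs = w)"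

definition delete_vertex :: "('v, 'e) mgraph \<Rightarrow> 'v \<Rightarrow> ('v, 'e) mgraph" where
  "delete_vertex G x =
     \<lparr>verts = verts G - {x}, edges = {e \<in> edges G. x \<notin> ends G e}, ends = ends G\<rparr>"

definition two_connected :: "('v, 'e) mgraph \<Rightarrow> bool" where
  "two_connected G \<longleftrightarrow> graph G \<and> card (verts G) \<ge> 3 \<and> connected G \<and>
     (\<forall>x\<in>verts G. connected (delete_vertex G x))"

definition component :: "('v, 'e) mgraph \<Rightarrow> ('v, 'e) mgraph \<Rightarrow> bool" where
  "component G C \<longleftrightarrow> subgraph C G \<and> connected C \<and>
     (\<forall>D. subgraph C D \<and> subgraph D G \<and> connected D \<longrightarrow> subgraph D C)"

definition eulerian :: "('v, 'e) mgraph \<Rightarrow> bool" where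
  "eulerian G \<longleftrightarrow> graph G \<and> (\<forall>x\<in>verts G. even (degree G x))"

text \<open>Open trails and paths as graphs; a single vertex is a (trivial) path.\<close>

definition open_trail :: "('v, 'e) mgraph \<Rightarrow> bool" where
  "open_trail T \<longleftrightarrow> graph T \<and>
     (\<exists>vs es. walk T vs es \<and> distinct es \<and> hd vs \<noteq> last vs \<and>
        verts T = set vs \<and> edges T = set es)"

definition path :: "('v, 'e) mgraph \<Rightarrow> bool" where
  "path T \<longleftrightarrow> graph T \<and>
     (\<exists>vs es. walk T vs es \<and> distinct vs \<and> verts T = set vs \<and> edges T = set es)"

definition linear_forest :: "('v, 'e) mgraph \<Rightarrow> bool" where
  "linear_forest P \<longleftrightarrow> graph P \<and> (\<forall>C. component P C \<longrightarrow> path C)"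

definition spanning_connected_subgraph :: "('v, 'e) mgraph \<Rightarrow> ('v, 'e) mgraph \<Rightarrow> bool" where
  "spanning_connected_subgraph S G \<longleftrightarrow> subgraph S G \<and> verts S = verts G \<and> connected S"

definition eps_graph ::
  "('v, 'e) mgraph \<Rightarrow> ('v, 'e) mgraph \<Rightarrow> ('v, 'e) mgraph \<Rightarrow> ('v, 'e) mgraph \<Rightarrow> bool" where
  "eps_graph G S E P \<longleftrightarrow>
     spanning_connected_subgraph S G \<and> subgraph E S \<and> subgraph P S \<and>
     verts S = verts E \<union> verts P \<and> edges S = edges E \<union> edges P \<and>
     edges E \<inter> edges P = {} \<and>
     eulerian E \<and> linear_forest P"

definition jeps_graph ::
  "('v, 'e) mgraph \<Rightarrow> ('v, 'e) mgraph \<Rightarrow> ('v, 'e) mgraph \<Rightarrow> ('v, 'e) mgraph \<Rightarrow> ('v, 'e) mgraph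
     \<Rightarrow> bool" where
  "jeps_graph G S J E P \<longleftrightarrow>
     spanning_connected_subgraph S G \<and> subgraph J S \<and> subgraph E S \<and> subgraph P S \<and>
     verts S = verts J \<union> verts E \<union> verts P \<and> edges S = edges J \<union> edges E \<union> edges P \<and>
     edges J \<inter> edges E = {} \<and> edges J \<inter> edges P = {} \<and> edges E \<inter> edges P = {} \<and>
     open_trail J \<and> eulerian E \<and> linear_forest P"

end

theory Submission
  imports Defs
begin

text \<open>
  Call $X \subseteq V(G)$ covered by disjoint edge sets $F$ and $P$ if all vertices outside $X$ have even
  degree in $F$, $P$ is a linear forest on $V(G) - X$, and every vertex is joined to $X$ by $F \cup P$.
  In a 2-connected graph every $X$ with at least two vertices is covered, by induction on
  $|V(G) - X|$: take an ear $p_0 \ldots p_n$ of $X$ and a cover of $X$ together with the inner vertices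
  of the ear. Starting with $p_0 p_1 \in F$ and switching between $F$ and $P$ at every inner vertex
  of odd $F$-degree distributes the ear edges so that all inner degrees become even; the last edge is
  dropped if it would have to go to $P$, so that no edge of $P$ meets $X$.

  Apply this to $X = \{v, w\}$. If the last edge of the first ear is not dropped, the ear
  joins $v$ to $w$. Otherwise an odd number of inner vertices have odd $F$-degree for the cover of
  the enlarged set, so by the handshake lemma some inner vertex is joined in that $F$ to $v$ or to
  $w$. Orienting the ear so that the dropped edge is at that end, $v$ and $w$ are again connected.
  So $F \cup P$ is connected, and the vertices of odd degree in $F$ are none, which gives (i), or
  exactly $v$ and $w$; in the latter case $F$ contains a path $J$ from $v$ to $w$, which gives (ii)
  with $E = F - J$.
\<close>

section \<open>Degrees, reachability, paths and linear forests of edge sets\<close>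

text \<open>Edge sets are paired with an incidence map \<open>d\<close> and not packed into a graph,
  so that \<open>F\<close>, \<open>P\<close> and the pieces of an ear can be united and split
  without tracking vertex sets.\<close>

definition deg :: "('e \<Rightarrow> 'v set) \<Rightarrow> 'e set \<Rightarrow> 'v \<Rightarrow> nat" where
  "deg d A x = card {e \<in> A. x \<in> d e}"

definition joins :: "('e \<Rightarrow> 'v set) \<Rightarrow> 'e set \<Rightarrow> ('v \<times> 'v) set" where
  "joins d A = {(x, y). \<exists>e\<in>A. d e = {x, y}}"

text \<open>Functions on indices make truncating, prepending a vertex and reversing plain index
  arithmetic; only \<open>p 0, ..., p n\<close> and \<open>f 0, ..., f (n - 1)\<close>
  matter.\<close>

definition upath :: "('e \<Rightarrow> 'v set) \<Rightarrow> 'e set \<Rightarrow> (nat \<Rightarrow> 'v) \<Rightarrow> (nat \<Rightarrow> 'e) \<Rightarrow> nat \<Rightarrow> bool" where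
  "upath d A p f n \<longleftrightarrow> inj_on p {..n} \<and> (\<forall>i<n. f i \<in> A \<and> d (f i) = {p i, p (Suc i)})"

text \<open>
  A linear forest is encoded by a linear order \<open>L\<close> of its vertices in which every edge
  joins two consecutive vertices; disjoint unions then become concatenations.
\<close>

definition along :: "('e \<Rightarrow> 'v set) \<Rightarrow> 'e set \<Rightarrow> 'v list \<Rightarrow> bool" where
  "along d P L \<longleftrightarrow> inj_on d P \<and> (\<forall>e\<in>P. \<exists>i. Suc i < length L \<and> d e = {L ! i, L ! Suc i})"

lemma deg_Un:
  assumes "finite A" "finite B" "A \<inter> B = {}"
  shows "deg d (A \<union> B) x = deg d A x + deg d B x"
proof -
  have "{e \<in> A \<union> B. x \<in> d e} = {e \<in> A. x \<in> d e} \<union> {e \<in> B. x \<in> d e}" by auto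
  then show ?thesis unfolding deg_def using assms by (simp add: card_Un_disjoint disjoint_iff)
qed

text \<open>Handshake lemma, by induction on the edges: each edge lies inside \<open>U\<close> or
  misses it, and so adds 2 or 0 to the sum.\<close>

lemma even_sum_deg:
  assumes "finite F" "finite U"
    and "\<And>e. e \<in> F \<Longrightarrow> card (d e) = 2 \<and> (d e \<subseteq> U \<or> d e \<inter> U = {})"
  shows "even (\<Sum>x\<in>U. deg d F x)"
  using assms(1,3)
proof (induction F rule: finite_induct)
  case empty
  then show ?case by (simp add: deg_def)
next
  case (insert e F)
  have "deg d (insert e F) x = deg d {e} x + deg d F x" for x
    using deg_Un[of "{e}" F d x] insert.hyps by simp
  then have "(\<Sum>x\<in>U. deg d (insert e F) x) = (\<Sum>x\<in>U. deg d {e} x) + (\<Sum>x\<in>U. deg d F x)"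
    by (simp add: sum.distrib)
  moreover have "deg d {e} x = (if x \<in> d e then 1 else 0)" for x
    by (auto simp: deg_def Collect_conv_if)
  then have "(\<Sum>x\<in>U. deg d {e} x) = card (U \<inter> d e)"
    using assms(2) by (simp add: sum.If_cases Int_def)
  moreover have "even (card (U \<inter> d e))"
  proof (cases "d e \<subseteq> U")
    case True
    then show ?thesis using insert.prems[of e] by (simp add: Int_absorb1)
  next
    case False
    then have "U \<inter> d e = {}" using insert.prems[of e] by auto
    then show ?thesis by simp
  qed
  ultimately show ?case using insert by simp
qed

lemma even_card_odd_deg:
  assumes "finite F" "finite U"
    and "\<And>e. e \<in> F \<Longrightarrow> card (d e) = 2 \<and> (d e \<subseteq> U \<or> d e \<inter> U = {})"
  shows "even (card {x \<in> U. odd (deg d F x)})"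
  using even_sum_deg[OF assms] even_sum_iff[OF assms(2), of "deg d F"] by simp

lemma joins_mono: "A \<subseteq> B \<Longrightarrow> (joins d A)\<^sup>* \<subseteq> (joins d B)\<^sup>*"
  by (rule rtrancl_mono) (auto simp: joins_def)

lemma joins_sym: "(x, y) \<in> (joins d A)\<^sup>* \<Longrightarrow> (y, x) \<in> (joins d A)\<^sup>*"
proof -
  have "sym (joins d A)" by (auto simp: sym_def joins_def insert_commute)
  then show "(x, y) \<in> (joins d A)\<^sup>* \<Longrightarrow> (y, x) \<in> (joins d A)\<^sup>*"
    by (meson sym_rtrancl symD)
qed

text \<open>The path grows with the reachability derivation; if the new vertex is already on it, the
  path is cut back to that vertex, which keeps \<open>p\<close> injective.\<close>

lemma upath_of_joins:
  assumes "(x, y) \<in> (joins d A)\<^sup>*"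
  obtains n p f where "upath d A p f n" "p 0 = x" "p n = y"
proof -
  have "\<exists>n p f. upath d A p f n \<and> p 0 = x \<and> p n = y"
    using assms
  proof (induction rule: rtrancl_induct)
    case base
    have "upath d A (\<lambda>_. x) undefined 0" by (simp add: upath_def)
    then show ?case by blast
  next
    case (step y z)
    then obtain n p f where p: "upath d A p f n" "p 0 = x" "p n = y" by blast
    obtain e where e: "e \<in> A" "d e = {y, z}" using step.hyps by (auto simp: joins_def)
    show ?case
    proof (cases "z \<in> p ` {..n}")
      case True
      then obtain m where "m \<le> n" "z = p m" by auto
      moreover have "upath d A p f m"
        using p(1) \<open>m \<le> n\<close> by (auto simp: upath_def intro: inj_on_subset)
      ultimately show ?thesis using p(2) by blast
    next
      case False
      have "inj_on (p(Suc n := z)) {..Suc n}"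
        using p(1) False by (auto simp: upath_def inj_on_def le_Suc_eq)
      then have "upath d A (p(Suc n := z)) (f(n := e)) (Suc n)"
        using p e by (auto simp: upath_def less_Suc_eq)
      moreover have "(p(Suc n := z)) 0 = x" "(p(Suc n := z)) (Suc n) = z" using p by auto
      ultimately show ?thesis by blast
    qed
  qed
  then show ?thesis using that by blast
qed

lemma upath_reach:
  assumes "\<And>i. i < n \<Longrightarrow> f i \<in> A \<and> d (f i) = {p i, p (Suc i)}"
  shows "(p 0, p n) \<in> (joins d A)\<^sup>*"
  using assms
proof (induction n)
  case (Suc n)
  then have "(p 0, p n) \<in> (joins d A)\<^sup>*" by simp
  moreover have "(p n, p (Suc n)) \<in> joins d A" using Suc.prems[of n] by (auto simp: joins_def)
  ultimately show ?case by simp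
qed simp

lemma upath_rev:
  assumes "upath d A p f n"
  shows "upath d A (\<lambda>i. p (n - i)) (\<lambda>i. f (n - Suc i)) n"
proof -
  have "inj_on (\<lambda>i. p (n - i)) {..n}"
  proof (rule inj_onI)
    fix i j assume ij: "i \<in> {..n}" "j \<in> {..n}" "p (n - i) = p (n - j)"
    then have "n - i = n - j" using assms by (auto simp: upath_def dest: inj_onD)
    then show "i = j" using ij by auto
  qed
  moreover have "f (n - Suc i) \<in> A \<and> d (f (n - Suc i)) = {p (n - i), p (n - Suc i)}" if "i < n" for i
  proof -
    have "Suc (n - Suc i) = n - i" "n - Suc i < n" using that by auto
    then show ?thesis using assms unfolding upath_def by (metis insert_commute)
  qed
  ultimately show ?thesis by (auto simp: upath_def)
qed

text \<open>Different indices give different pairs \<open>{i, Suc i}\<close>, and \<open>p\<close>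
  is injective. Hence a path has neither repeated nor parallel edges.\<close>

lemma upath_inj_edges:
  assumes "upath d A p f n"
  shows "inj_on (\<lambda>i. d (f i)) {..<n}"
proof (rule inj_onI)
  fix i j assume ij: "i \<in> {..<n}" "j \<in> {..<n}" "d (f i) = d (f j)"
  then have "{p i, p (Suc i)} = {p j, p (Suc j)}" using assms by (auto simp: upath_def)
  moreover have "inj_on p {..n}" using assms by (simp add: upath_def)
  then have "p ` {i, Suc i} = p ` {j, Suc j} \<longleftrightarrow> {i, Suc i} = {j, Suc j}"
    by (rule inj_on_image_eq_iff) (use ij in auto)
  ultimately show "i = j" by (auto simp: doubleton_eq_iff)
qed

lemma upath_deg:
  assumes p: "upath d A p f n" and I: "I \<subseteq> {..<n}" and i: "i \<le> n"
  shows "deg d (f ` I) (p i) = card {j \<in> I. j = i \<or> Suc j = i}"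
proof -
  have "p i \<in> d (f j) \<longleftrightarrow> j = i \<or> Suc j = i" if "j \<in> I" for j
  proof -
    have "j < n" using that I by auto
    then have "d (f j) = {p j, p (Suc j)}" "Suc j \<le> n" using p by (auto simp: upath_def)
    moreover have "p i = p j \<longleftrightarrow> j = i" "p i = p (Suc j) \<longleftrightarrow> Suc j = i"
      using p i \<open>j < n\<close> unfolding upath_def by (auto dest!: inj_onD)
    ultimately show ?thesis by auto
  qed
  then have "{e \<in> f ` I. p i \<in> d e} = f ` {j \<in> I. j = i \<or> Suc j = i}" by auto
  moreover have "inj_on f {..<n}" 
    using upath_inj_edges[OF p] by (auto simp: inj_on_def)
  then have "inj_on f {j \<in> I. j = i \<or> Suc j = i}" using I by (auto intro: inj_on_subset)
  ultimately show ?thesis by (simp add: deg_def card_image)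
qed

lemma upath_deg_inner:
  assumes p: "upath d A p f n" and I: "I \<subseteq> {..<n}" and i: "Suc i < n"
  shows "deg d (f ` I) (p (Suc i)) = of_bool (i \<in> I) + of_bool (Suc i \<in> I)"
proof -
  have "{j \<in> I. j = Suc i \<or> Suc j = Suc i} = (if i \<in> I then {i} else {}) \<union> (if Suc i \<in> I then {Suc i} else {})"
    by auto
  then show ?thesis using upath_deg[OF p I, of "Suc i"] i by auto
qed

lemma deg_outside:
  assumes "\<And>e. e \<in> A \<Longrightarrow> x \<notin> d e"
  shows "deg d A x = 0"
  using assms by (auto simp: deg_def card_eq_0_iff)

text \<open>The lists are disjoint, so an edge of \<open>P\<close> and an edge of \<open>K\<close>
  never have the same ends. The junction of \<open>L\<close> and \<open>M\<close> is a consecutive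
  pair that carries no edge.\<close>

lemma along_append:
  assumes "along d P L" "along d K M" "set L \<inter> set M = {}"
  shows "along d (P \<union> K) (L @ M)"
proof -
  have P: "d e \<subseteq> set L \<and> d e \<noteq> {}" if "e \<in> P" for e
    using assms(1) that by (fastforce simp: along_def)
  have K: "d e \<subseteq> set M \<and> d e \<noteq> {}" if "e \<in> K" for e
    using assms(2) that by (fastforce simp: along_def)
  have "d e \<noteq> d e'" if "e \<in> P" "e' \<in> K" for e e'
    using P[OF that(1)] K[OF that(2)] assms(3) by blast
  then have "inj_on d (P \<union> K)"
    using assms(1,2) unfolding along_def inj_on_def by (metis UnE)
  moreover have "\<exists>i. Suc i < length (L @ M) \<and> d e = {(L @ M) ! i, (L @ M) ! Suc i}"
    if e: "e \<in> P \<union> K" for e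
  proof (cases "e \<in> P")
    case True
    then obtain i where "Suc i < length L" "d e = {L ! i, L ! Suc i}"
      using assms(1) by (auto simp: along_def)
    then show ?thesis by (intro exI[of _ i]) (auto simp: nth_append)
  next
    case False
    then obtain i where "Suc i < length M" "d e = {M ! i, M ! Suc i}"
      using assms(2) e by (auto simp: along_def)
    then show ?thesis by (intro exI[of _ "length L + i"]) (auto simp: nth_append)
  qed
  ultimately show ?thesis by (simp add: along_def)
qed

section \<open>Distributing the edges of an ear\<close>

text \<open>Along the ear the side changes at every inner vertex in \<open>T\<close>, so the
  \<open>J\<close>-degree of an inner vertex is odd exactly there. \<open>K\<close> must avoid both
  ends of the ear: the first edge always goes to \<open>J\<close>, and the last one is left out if
  it would fall to \<open>K\<close>.\<close>

lemma split_ear: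
  assumes p: "upath d A p f n" and n: "0 < n"
  obtains J K where "J \<union> K \<subseteq> f ` {..<n}" "J \<inter> K = {}"
    "\<And>i. Suc i < n \<Longrightarrow> f i \<in> J \<union> K"
    "even (card (T \<inter> p ` {0<..<n})) \<Longrightarrow> f (n - 1) \<in> J"
    "\<And>i. 0 < i \<Longrightarrow> i < n \<Longrightarrow> odd (deg d J (p i)) \<longleftrightarrow> p i \<in> T"
    "along d K (map p [1..<n])"
proof -
  \<comment> \<open>\<open>c i\<close> counts the side changes up to \<open>p i\<close>; its parity
    decides the side of the edge \<open>f i\<close>.\<close>
  define c where "c i = card {j. 0 < j \<and> j \<le> i \<and> p j \<in> T}" for i
  have cS: "c (Suc i) = c i + of_bool (p (Suc i) \<in> T)" for i
  proof -
    have "{j. 0 < j \<and> j \<le> Suc i \<and> p j \<in> T} =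
      {j. 0 < j \<and> j \<le> i \<and> p j \<in> T} \<union> (if p (Suc i) \<in> T then {Suc i} else {})"
      by (auto simp: le_Suc_eq)
    then show ?thesis by (auto simp: c_def)
  qed
  define I where "I = {i. i < n \<and> even (c i)}"
  \<comment> \<open>\<open>Suc i < n\<close> instead of \<open>i < n\<close> drops the last edge in
    the odd case, since it would bring \<open>p n\<close> into \<open>K\<close>.\<close>
  define I' where "I' = {i. Suc i < n \<and> odd (c i)}"
  have inj: "inj_on (\<lambda>i. d (f i)) {..<n}" by (rule upath_inj_edges[OF p])
  then have injf: "inj_on f {..<n}" by (auto simp: inj_on_def)
  have c0: "c 0 = 0" by (auto simp: c_def)
  show ?thesis
  proof (rule that[of "f ` I" "f ` I'"])
    show "f ` I \<union> f ` I' \<subseteq> f ` {..<n}" by (auto simp: I_def I'_def)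
    show "f ` I \<inter> f ` I' = {}"
    proof -
      have "f ` (I \<inter> I') = f ` I \<inter> f ` I'"
        by (rule inj_on_image_Int[OF injf]) (auto simp: I_def I'_def)
      moreover have "I \<inter> I' = {}" by (auto simp: I_def I'_def)
      ultimately show ?thesis by simp
    qed
    show "f i \<in> f ` I \<union> f ` I'" if "Suc i < n" for i
      using that by (auto simp: I_def I'_def)
    show "f (n - 1) \<in> f ` I" if "even (card (T \<inter> p ` {0<..<n}))"
    proof -
      have "T \<inter> p ` {0<..<n} = p ` {j. 0 < j \<and> j \<le> n - 1 \<and> p j \<in> T}" by auto
      moreover have "inj_on p {j. 0 < j \<and> j \<le> n - 1 \<and> p j \<in> T}"
        using p by (auto simp: upath_def inj_on_def)
      ultimately have "even (c (n - 1))" using that by (simp add: c_def card_image)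
      then show ?thesis using n by (auto simp: I_def)
    qed
    show "odd (deg d (f ` I) (p i)) \<longleftrightarrow> p i \<in> T" if i: "0 < i" "i < n" for i
    proof -
      obtain k where k: "i = Suc k" using i by (cases i) auto
      have "I \<subseteq> {..<n}" by (auto simp: I_def)
      from upath_deg_inner[OF p this, of k] show ?thesis
        using i k cS[of k] by (auto simp: I_def)
    qed
    show "along d (f ` I') (map p [1..<n])"
    proof -
      have "inj_on d (f ` I')"
      proof -
        have "inj_on (d \<circ> f) I'" using inj by (auto simp: I'_def inj_on_def)
        then show ?thesis by (rule inj_on_imageI)
      qed
      moreover have "\<exists>k. Suc k < length (map p [1..<n]) \<and>
          d (f i) = {map p [1..<n] ! k, map p [1..<n] ! Suc k}" if i: "i \<in> I'" for i
      proof -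
        \<comment> \<open>As \<open>c 0 = 0\<close>, the first edge is in \<open>J\<close>. So
          \<open>f i\<close> joins inner vertices, which stand at positions \<open>i - 1\<close> and
          \<open>i\<close> of a list that starts with \<open>p 1\<close>.\<close>
        have "0 < i" using i c0 by (cases i) (auto simp: I'_def)
        then show ?thesis
          using i p by (intro exI[of _ "i - 1"]) (auto simp: I'_def upath_def)
      qed
      ultimately show ?thesis by (auto simp: along_def)
    qed
  qed
qed

section \<open>Connectedness, and ears in 2-connected graphs\<close>

lemma joins_of_connected:
  assumes "connected H" "u \<in> verts H" "x \<in> verts H"
  shows "(u, x) \<in> (joins (ends H) (edges H))\<^sup>*"
proof -
  obtain vs es where w: "walk H vs es" "hd vs = u" "last vs = x"
    using assms unfolding connected_def by blast
  then have len: "length vs = Suc (length es)" by (simp add: walk_def)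
  have "(vs ! 0, vs ! length es) \<in> (joins (ends H) (edges H))\<^sup>*"
  proof (rule upath_reach[where p = "\<lambda>i. vs ! i" and f = "\<lambda>i. es ! i" and n = "length es"])
    fix i assume "i < length es"
    then show "es ! i \<in> edges H \<and> ends H (es ! i) = {vs ! i, vs ! Suc i}"
      using w(1) nth_mem[of i es] unfolding walk_def by blast
  qed
  moreover have "vs \<noteq> []" using len by auto
  ultimately show ?thesis using w len by (auto simp: hd_conv_nth last_conv_nth)
qed

lemma walk_of_upath:
  assumes "upath (ends H) (edges H) p f n" "p ` {..n} \<subseteq> verts H"
  shows "walk H (map p [0..<Suc n]) (map f [0..<n])"
  using assms by (auto simp: walk_def upath_def nth_append simp del: upt_Suc)

lemma connectedI:
  assumes "graph H" "verts H \<noteq> {}"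
    and "\<And>u x. u \<in> verts H \<Longrightarrow> x \<in> verts H \<Longrightarrow> (u, x) \<in> (joins (ends H) (edges H))\<^sup>*"
  shows "connected H"
proof -
  have "\<exists>vs es. walk H vs es \<and> hd vs = u \<and> last vs = x" if ux: "u \<in> verts H" "x \<in> verts H" for u x
  proof -
    obtain n p f where p: "upath (ends H) (edges H) p f n" "p 0 = u" "p n = x"
      by (rule upath_of_joins[OF assms(3)[OF ux]])
    have "p i \<in> verts H" if "i \<le> n" for i
    proof (cases i)
      case (Suc k)
      then have "f k \<in> edges H" "p i \<in> ends H (f k)" using p that by (auto simp: upath_def)
      then show ?thesis using assms(1) by (auto simp: graph_def)
    qed (use p ux in auto)
    then have "walk H (map p [0..<Suc n]) (map f [0..<n])" by (intro walk_of_upath p) auto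
    moreover have "hd (map p [0..<Suc n]) = u" "last (map p [0..<Suc n]) = x"
      using p by (auto simp: hd_map last_map simp del: upt_Suc)
    ultimately show ?thesis by blast
  qed
  then show ?thesis using assms by (auto simp: connected_def)
qed

text \<open>Some edge leaves \<open>X\<close> from \<open>x\<close> to \<open>q\<close>. As
  \<open>G - x\<close> is connected, a path avoiding \<open>x\<close> leads from \<open>q\<close> to
  another vertex of \<open>X\<close>; cut at its first vertex in \<open>X\<close> and preceded by
  the edge from \<open>x\<close> to \<open>q\<close>, it is an ear.\<close>

lemma ear_exists:
  assumes G: "two_connected G" and X: "X \<subseteq> verts G" "card X \<ge> 2" "X \<noteq> verts G"
  obtains p f n where "upath (ends G) (edges G) p f n" "2 \<le> n" "p 0 \<in> X" "p n \<in> X"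
    "p ` {0<..<n} \<subseteq> verts G - X"
proof -
  have gr: "graph G" and con: "connected G" using G by (auto simp: two_connected_def)
  have finX: "finite X" using X(2) by (auto intro: card_ge_0_finite)
  obtain a where a: "a \<in> X" using X(2) by fastforce
  obtain b where b: "b \<in> verts G" "b \<notin> X" using X by auto
  have "(a, b) \<in> (joins (ends G) (edges G))\<^sup>*" using joins_of_connected[OF con] a b X by auto
  then have "\<exists>x q. x \<in> X \<and> q \<notin> X \<and> (x, q) \<in> joins (ends G) (edges G)"
    using b(2)
  proof (induction rule: rtrancl_induct)
    case base
    then show ?case using a by simp
  next
    case (step y z)
    then show ?case by blast
  qed
  then obtain x q e where x: "x \<in> X" "q \<notin> X" "e \<in> edges G" "ends G e = {x, q}"
    by (auto simp: joins_def)
  have qV: "q \<in> verts G" using x gr by (auto simp: graph_def)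
  have "card (X - {x}) \<ge> 1" using X(2) x finX by simp
  then have "X - {x} \<noteq> {}" by force
  then obtain y where y: "y \<in> X" "y \<noteq> x" by blast
  let ?H = "delete_vertex G x"
  have "connected ?H" using G x X by (auto simp: two_connected_def)
  from joins_of_connected[OF this, of q y]
  have "(q, y) \<in> (joins (ends ?H) (edges ?H))\<^sup>*"
    using x y X qV by (auto simp: delete_vertex_def)
  then obtain m p f where p: "upath (ends ?H) (edges ?H) p f m" "p 0 = q" "p m = y"
    by (rule upath_of_joins)
  define k where "k = (LEAST i. p i \<in> X)"
  have pk: "p k \<in> X" unfolding k_def by (rule LeastI[of _ m]) (use p y in simp)
  have km: "k \<le> m" unfolding k_def by (rule Least_le) (use p y in simp)
  have kmin: "p i \<notin> X" if "i < k" for i using that not_less_Least k_def by blast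
  have k0: "0 < k" using pk p x by (cases k) auto
  have edg: "f i \<in> edges G" "ends G (f i) = {p i, p (Suc i)}" "x \<notin> ends G (f i)" if "i < m" for i
    using p(1) that by (auto simp: upath_def delete_vertex_def)
  \<comment> \<open>Each vertex is read off from an incident edge of \<open>G - x\<close>:
    \<open>p i\<close> from \<open>f i\<close>, but the last vertex \<open>p m\<close> from
    \<open>f (m - 1)\<close>, which exists because \<open>0 < k\<close>.\<close>
  have nx: "p i \<noteq> x \<and> p i \<in> verts G" if "i \<le> k" for i
  proof (cases "i < m")
    case True
    then show ?thesis using edg[of i] gr by (auto simp: graph_def)
  next
    case False
    then have "i = Suc (m - 1)" "m - 1 < m" using that km k0 by auto
    then show ?thesis using edg[of "m - 1"] gr by (auto simp: graph_def)
  qed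
  \<comment> \<open>Prepending \<open>x\<close> shifts the indices by one. The ear has length
    \<open>Suc k\<close>, which is at least 2 because \<open>q\<close> is outside
    \<open>X\<close>.\<close>
  define p' where "p' = (\<lambda>i. case i of 0 \<Rightarrow> x | Suc j \<Rightarrow> p j)"
  define f' where "f' = (\<lambda>i. case i of 0 \<Rightarrow> e | Suc j \<Rightarrow> f j)"
  have "inj_on p' {..Suc k}"
  proof (rule inj_onI)
    fix i j assume ij: "i \<in> {..Suc k}" "j \<in> {..Suc k}" "p' i = p' j"
    moreover have "inj_on p {..k}" using p(1) km by (auto simp: upath_def intro: inj_on_subset)
    moreover have "p l \<noteq> x" if "l \<le> k" for l using nx that by blast
    ultimately show "i = j"
      by (auto simp: p'_def inj_on_def split: nat.splits)
  qed
  moreover have "f' i \<in> edges G \<and> ends G (f' i) = {p' i, p' (Suc i)}" if "i < Suc k" for i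
    using that x p(2) edg km by (cases i) (auto simp: p'_def f'_def)
  ultimately have "upath (ends G) (edges G) p' f' (Suc k)" by (simp add: upath_def)
  moreover have "p' ` {0<..<Suc k} \<subseteq> verts G - X"
  proof
    fix z assume "z \<in> p' ` {0<..<Suc k}"
    then obtain i where "0 < i" "i < Suc k" "z = p' i" by auto
    then show "z \<in> verts G - X" using nx kmin by (cases i) (auto simp: p'_def)
  qed
  ultimately show ?thesis using that[of p' f' "Suc k"] k0 pk x(1) by (auto simp: p'_def)
qed

section \<open>Covers of a vertex set\<close>

text \<open>That no edge lies inside \<open>X\<close> keeps a cover disjoint from an ear added
  later. \<open>L\<close> lists the vertices outside \<open>X\<close>, so \<open>along\<close> also
  keeps the edges of \<open>P\<close> away from \<open>X\<close>.\<close>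

definition covers ::
  "('v, 'e) mgraph \<Rightarrow> 'v set \<Rightarrow> 'e set \<Rightarrow> 'e set \<Rightarrow> 'v list \<Rightarrow> bool" where
  "covers G X F P L \<longleftrightarrow> F \<subseteq> edges G \<and> P \<subseteq> edges G \<and> F \<inter> P = {} \<and>
    (\<forall>e\<in>F \<union> P. \<not> ends G e \<subseteq> X) \<and>
    (\<forall>u\<in>verts G - X. even (deg (ends G) F u)) \<and>
    distinct L \<and> set L = verts G - X \<and> along (ends G) P L \<and>
    (\<forall>u\<in>verts G. \<exists>z\<in>X. (u, z) \<in> (joins (ends G) (F \<union> P))\<^sup>*)"

text \<open>The ear is split with \<open>T\<close> the vertices of odd \<open>F\<close>-degree, so
  the two degrees add up to an even number at inner vertices. A vertex joined to an inner vertex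
  gets back to \<open>p 0\<close> along the ear. The further conclusions record which edges
  survive.\<close>

lemma covers_add_ear:
  assumes G: "graph G" and p: "upath (ends G) (edges G) p f n" "2 \<le> n" "p 0 \<in> X" "p n \<in> X"
    and pX: "p ` {0<..<n} \<subseteq> verts G - X"
    and cov: "covers G (X \<union> p ` {0<..<n}) F P L"
  obtains F' P' L' where "covers G X F' P' L'" "F \<union> P \<subseteq> F' \<union> P'"
    "\<And>i. Suc i < n \<Longrightarrow> f i \<in> F' \<union> P'"
    "even (card ({u. odd (deg (ends G) F u)} \<inter> p ` {0<..<n})) \<Longrightarrow> f (n - 1) \<in> F' \<union> P'"
proof -
  let ?d = "ends G"
  let ?T = "{u. odd (deg ?d F u)}"
  define Q where "Q = p ` {0<..<n}"
  have IH: "F \<subseteq> edges G" "P \<subseteq> edges G" "F \<inter> P = {}"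
    and ninX: "\<forall>e\<in>F \<union> P. \<not> ?d e \<subseteq> X \<union> Q"
    and ev: "\<forall>u\<in>verts G - (X \<union> Q). even (deg ?d F u)"
    and L: "distinct L" "set L = verts G - (X \<union> Q)" "along ?d P L"
    and con: "\<forall>u\<in>verts G. \<exists>z\<in>X \<union> Q. (u, z) \<in> (joins ?d (F \<union> P))\<^sup>*"
    using cov unfolding covers_def Q_def by blast+
  have "0 < n" using p by simp
  obtain J K where JK: "J \<union> K \<subseteq> f ` {..<n}" "J \<inter> K = {}"
    and keep: "\<And>i. Suc i < n \<Longrightarrow> f i \<in> J \<union> K"
    and last: "even (card (?T \<inter> p ` {0<..<n})) \<Longrightarrow> f (n - 1) \<in> J"
    and odd: "\<And>i. 0 < i \<Longrightarrow> i < n \<Longrightarrow> odd (deg ?d J (p i)) \<longleftrightarrow> p i \<in> ?T"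
    and K: "along ?d K (map p [1..<n])"
    using split_ear[OF p(1) \<open>0 < n\<close>, of ?T] by metis
  have pXQ: "p i \<in> X \<union> Q" if "i \<le> n" for i
    using that p by (cases "i = 0 \<or> i = n") (auto simp: Q_def)
  have fe: "f i \<in> edges G \<and> ?d (f i) = {p i, p (Suc i)}" if "i < n" for i
    using p(1) that by (auto simp: upath_def)
  \<comment> \<open>As \<open>2 \<le> n\<close>, every ear edge has an inner end, so it is not
    inside \<open>X\<close>.\<close>
  have fXQ: "?d e \<subseteq> X \<union> Q \<and> \<not> ?d e \<subseteq> X \<and> e \<in> edges G" if e: "e \<in> f ` {..<n}" for e
  proof -
    obtain i where i: "i < n" "e = f i" using e by auto
    have "p i \<in> Q \<or> p (Suc i) \<in> Q"
      using i p(2) by (cases "i = 0") (auto simp: Q_def)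
    then show ?thesis using fe[OF i(1)] i pXQ[of i] pXQ[of "Suc i"] pX by (auto simp: Q_def)
  qed
  have JKE: "J \<union> K \<subseteq> edges G" using fXQ JK(1) by blast
  \<comment> \<open>Edges of the given cover never lie inside \<open>X \<union> Q\<close>, ear edges
    always do.\<close>
  have dis: "(F \<union> P) \<inter> (J \<union> K) = {}" using fXQ JK ninX by blast
  have finE: "finite (edges G)" using G by (simp add: graph_def)
  have finF: "finite F" "finite J" using IH finE JKE by (auto intro: finite_subset)
  have "covers G X (F \<union> J) (P \<union> K) (L @ map p [1..<n])"
    unfolding covers_def
  proof (intro conjI)
    show "F \<union> J \<subseteq> edges G" "P \<union> K \<subseteq> edges G" using IH(1,2) JKE by auto
    show "(F \<union> J) \<inter> (P \<union> K) = {}" using IH JK dis by blast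
    show "\<forall>e\<in>(F \<union> J) \<union> (P \<union> K). \<not> ?d e \<subseteq> X" using ninX fXQ JK(1) by blast
    show "\<forall>u\<in>verts G - X. even (deg ?d (F \<union> J) u)"
    proof
      fix u assume u: "u \<in> verts G - X"
      have sum: "deg ?d (F \<union> J) u = deg ?d F u + deg ?d J u"
        using finF dis by (intro deg_Un) auto
      show "even (deg ?d (F \<union> J) u)"
      proof (cases "u \<in> Q")
        case True
        then show ?thesis using sum odd by (auto simp: Q_def)
      next
        case False
        then have "deg ?d J u = 0" using u fXQ JK(1) by (intro deg_outside) blast
        then show ?thesis using sum ev u False by auto
      qed
    qed
    have "set (map p [1..<n]) = Q" by (auto simp: Q_def)
    moreover have "distinct (map p [1..<n])"
      using p(1) by (auto simp: distinct_map upath_def inj_on_def)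
    ultimately show "distinct (L @ map p [1..<n])" "set (L @ map p [1..<n]) = verts G - X"
      "along ?d (P \<union> K) (L @ map p [1..<n])"
      using L pX along_append[OF L(3) K] by (auto simp: Q_def)
    show "\<forall>u\<in>verts G. \<exists>z\<in>X. (u, z) \<in> (joins ?d ((F \<union> J) \<union> (P \<union> K)))\<^sup>*"
    proof
      fix u assume "u \<in> verts G"
      then obtain z where z: "z \<in> X \<union> Q" "(u, z) \<in> (joins ?d (F \<union> P))\<^sup>*" using con by blast
      then have uz: "(u, z) \<in> (joins ?d ((F \<union> J) \<union> (P \<union> K)))\<^sup>*"
        using joins_mono[of "F \<union> P" "(F \<union> J) \<union> (P \<union> K)" ?d] by auto
      show "\<exists>z\<in>X. (u, z) \<in> (joins ?d ((F \<union> J) \<union> (P \<union> K)))\<^sup>*"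
      proof (cases "z \<in> X")
        case True
        then show ?thesis using uz by blast
      next
        case False
        then obtain i where i: "i < n" "z = p i" using z by (auto simp: Q_def)
        \<comment> \<open>Here \<open>j < i < n\<close>, so the edge that may have been dropped is
          not on the way to \<open>p 0\<close>.\<close>
        have "f j \<in> (F \<union> J) \<union> (P \<union> K) \<and> ?d (f j) = {p j, p (Suc j)}" if "j < i" for j
          using keep[of j] fe[of j] that i(1) by auto
        then have "(p 0, p i) \<in> (joins ?d ((F \<union> J) \<union> (P \<union> K)))\<^sup>*"
          by (rule upath_reach[where p = p and f = f and n = i])
        then have "(u, p 0) \<in> (joins ?d ((F \<union> J) \<union> (P \<union> K)))\<^sup>*"
          using uz i(2) joins_sym[of "p 0" "p i"] rtrancl_trans[of u z _ "p 0"] by blast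
        then show ?thesis using p(3) by blast
      qed
    qed
  qed
  then show ?thesis by (rule that) (use keep last in auto)
qed

lemma covers_exists:
  assumes G: "two_connected G" and "X \<subseteq> verts G" "card X \<ge> 2"
  shows "\<exists>F P L. covers G X F P L"
  using assms(2,3)
proof (induction "card (verts G - X)" arbitrary: X rule: less_induct)
  case less
  have gr: "graph G" and finV: "finite (verts G)"
    using G by (auto simp: two_connected_def graph_def)
  show ?case
  proof (cases "X = verts G")
    case True
    then have "covers G X {} {} []" by (auto simp: covers_def along_def)
    then show ?thesis by blast
  next
    case False
    obtain p f n where p: "upath (ends G) (edges G) p f n" "2 \<le> n" "p 0 \<in> X" "p n \<in> X"
      and pX: "p ` {0<..<n} \<subseteq> verts G - X"
      using ear_exists[OF G less.prems(1,2) False] by blast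
    let ?Y = "X \<union> p ` {0<..<n}"
    \<comment> \<open>\<open>2 \<le> n\<close> makes \<open>p 1\<close> an inner vertex, so the
      induction measure drops.\<close>
    have "p 1 \<in> p ` {0<..<n}" using p by auto
    then have "card (verts G - ?Y) < card (verts G - X)"
      using finV pX by (intro psubset_card_mono) auto
    moreover have "?Y \<subseteq> verts G" using pX less.prems by auto
    moreover have "card ?Y \<ge> 2"
      using less.prems(2) card_mono[of ?Y X] finite_subset[OF \<open>?Y \<subseteq> verts G\<close> finV] by simp
    ultimately obtain F P L where "covers G ?Y F P L" using less.hyps by blast
    then show ?thesis using covers_add_ear[OF gr p pX] by metis
  qed
qed

section \<open>Connecting the two prescribed vertices\<close>

text \<open>The image \<open>(joins d F)\<^sup>* `` A\<close> is the union of the components of \<open>F\<close> that meet \<open>A\<close>.\<close>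

lemma even_card_odd_component:
  assumes G: "graph G" and F: "F \<subseteq> edges G" and A: "A \<subseteq> verts G"
  shows "even (card {x \<in> (joins (ends G) F)\<^sup>* `` A. odd (deg (ends G) F x)})"
proof (rule even_card_odd_deg)
  let ?U = "(joins (ends G) F)\<^sup>* `` A"
  show "finite F" using G F by (auto simp: graph_def intro: finite_subset)
  have "x \<in> verts G" if "(a, x) \<in> (joins (ends G) F)\<^sup>*" "a \<in> A" for a x
    using that
  proof (induction rule: rtrancl_induct)
    case base
    then show ?case using A by auto
  next
    case (step y z)
    then show ?case using G F by (fastforce simp: joins_def graph_def)
  qed
  then have "?U \<subseteq> verts G" by blast
  then show "finite ?U" using G by (auto simp: graph_def intro: finite_subset)
  fix e assume e: "e \<in> F"
  then have "card (ends G e) = 2" using G F by (auto simp: graph_def)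
  then obtain x y where xy: "ends G e = {x, y}" by (meson card_2_iff)
  then have "(x, y) \<in> joins (ends G) F" "(y, x) \<in> joins (ends G) F"
    using e by (auto simp: joins_def insert_commute)
  then have "x \<in> ?U \<longleftrightarrow> y \<in> ?U" by (meson Image_iff rtrancl.rtrancl_into_rtrancl)
  then show "card (ends G e) = 2 \<and> (ends G e \<subseteq> ?U \<or> ends G e \<inter> ?U = {})"
    using xy \<open>card (ends G e) = 2\<close> by auto
qed

text \<open>The ear survives up to \<open>p (n - 1)\<close>. Either its last edge survives as well,
  or a route in \<open>F\<close> from an inner vertex to \<open>p n\<close> replaces the end of the
  ear. The second alternative favours the end \<open>p n\<close>, so the lemma is applied to an ear
  or to its reversal.\<close>

lemma covers_close:
  assumes G: "graph G" and p: "upath (ends G) (edges G) p f n" "2 \<le> n" "p 0 \<in> X" "p n \<in> X"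
    and pX: "p ` {0<..<n} \<subseteq> verts G - X"
    and cov: "covers G (X \<union> p ` {0<..<n}) F P L"
    and q: "even (card ({u. odd (deg (ends G) F u)} \<inter> p ` {0<..<n})) \<or>
      (\<exists>q \<in> p ` {0<..<n}. (q, p n) \<in> (joins (ends G) F)\<^sup>*)"
  shows "\<exists>F P L. covers G X F P L \<and> (p 0, p n) \<in> (joins (ends G) (F \<union> P))\<^sup>*"
proof -
  let ?d = "ends G"
  obtain F' P' L' where F': "covers G X F' P' L'" "F \<union> P \<subseteq> F' \<union> P'"
    and keep: "\<And>i. Suc i < n \<Longrightarrow> f i \<in> F' \<union> P'"
    and last: "even (card ({u. odd (deg ?d F u)} \<inter> p ` {0<..<n})) \<Longrightarrow> f (n - 1) \<in> F' \<union> P'"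
    using covers_add_ear[OF G p pX cov] by metis
  have fe: "?d (f i) = {p i, p (Suc i)}" if "i < n" for i
    using p(1) that by (auto simp: upath_def)
  have "(p 0, p n) \<in> (joins ?d (F' \<union> P'))\<^sup>*"
    using q
  proof
    assume "even (card ({u. odd (deg ?d F u)} \<inter> p ` {0<..<n}))"
    then have "f i \<in> F' \<union> P'" if "i < n" for i
      using last keep[of i] that by (cases "Suc i = n") auto
    then show ?thesis using fe by (intro upath_reach[where p = p and f = f and n = n]) auto
  next
    assume "\<exists>q \<in> p ` {0<..<n}. (q, p n) \<in> (joins ?d F)\<^sup>*"
    then obtain i where i: "0 < i" "i < n" "(p i, p n) \<in> (joins ?d F)\<^sup>*" by auto
    have "(p 0, p i) \<in> (joins ?d (F' \<union> P'))\<^sup>*"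
      using fe keep i by (intro upath_reach[where p = p and f = f and n = i]) auto
    moreover have "(p i, p n) \<in> (joins ?d (F' \<union> P'))\<^sup>*"
      using i(3) F'(2) joins_mono[of F "F' \<union> P'" ?d] by auto
    ultimately show ?thesis by (rule rtrancl_trans)
  qed
  then show ?thesis using F'(1) by blast
qed

lemma covers_pair_connected:
  assumes G: "two_connected G" and v: "v \<in> verts G" and w: "w \<in> verts G" and vw: "v \<noteq> w"
  obtains F P L where "covers G {v, w} F P L" "(v, w) \<in> (joins (ends G) (F \<union> P))\<^sup>*"
proof -
  let ?d = "ends G" and ?X = "{v, w}"
  have gr: "graph G" using G by (simp add: two_connected_def)
  have X: "?X \<subseteq> verts G" "card ?X \<ge> 2" using v w vw by auto
  have "card ?X < card (verts G)" using G vw by (simp add: two_connected_def)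
  then have "?X \<noteq> verts G" by (metis less_irrefl)
  with X obtain p f n where p: "upath ?d (edges G) p f n" "2 \<le> n" "p 0 \<in> ?X" "p n \<in> ?X"
    and pX: "p ` {0<..<n} \<subseteq> verts G - ?X"
    using ear_exists[OF G] by blast
  let ?Q = "p ` {0<..<n}"
  have "inj_on p {..n}" using p by (simp add: upath_def)
  then have "p 0 \<noteq> p n" using p(2) inj_on_eq_iff[of p "{..n}" 0 n] by simp
  \<comment> \<open>The ear may run from \<open>v\<close> to \<open>w\<close> or from
    \<open>w\<close> to \<open>v\<close>; only the set of its ends is fixed.\<close>
  then have ends: "{p 0, p n} = ?X" using p by auto
  have Y: "?X \<union> ?Q \<subseteq> verts G" using X(1) pX by blast
  then have "finite (?X \<union> ?Q)" using gr by (auto simp: graph_def intro: finite_subset)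
  then have "card (?X \<union> ?Q) \<ge> 2" using X(2) card_mono[of "?X \<union> ?Q" ?X] by simp
  then obtain F P L where cov: "covers G (?X \<union> ?Q) F P L"
    using covers_exists[OF G Y] by blast
  let ?T = "{u. odd (deg ?d F u)}" and ?U = "(joins ?d F)\<^sup>* `` ?Q"
  have "\<exists>F P L. covers G ?X F P L \<and> (v, w) \<in> (joins ?d (F \<union> P))\<^sup>*"
  proof (cases "even (card (?T \<inter> ?Q)) \<or> p n \<in> ?U")
    case True
    then have "\<exists>F P L. covers G ?X F P L \<and> (p 0, p n) \<in> (joins ?d (F \<union> P))\<^sup>*"
      by (intro covers_close[OF gr p pX cov]) auto
    then show ?thesis using ends joins_sym by (metis doubleton_eq_iff)
  next
    case False
    \<comment> \<open>If \<open>?U\<close> contained neither \<open>p 0\<close> nor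
      \<open>p n\<close>, its vertices of odd \<open>F\<close>-degree would be those of
      \<open>?T \<inter> ?Q\<close>. Their number is odd, against the handshake lemma.\<close>
    have "p 0 \<in> ?U"
    proof (rule ccontr)
      assume "p 0 \<notin> ?U"
      have F: "F \<subseteq> edges G" and "\<forall>u\<in>verts G - (?X \<union> ?Q). even (deg ?d F u)"
        using cov by (auto simp: covers_def)
      then have "u \<in> ?Q" if "u \<in> ?U" "odd (deg ?d F u)" for u
      proof -
        have "u \<noteq> p 0" "u \<noteq> p n" using that(1) \<open>p 0 \<notin> ?U\<close> False by blast+
        then have "u \<notin> ?X" using ends by blast
        moreover have "u \<in> verts G"
        proof (rule ccontr)
          assume "u \<notin> verts G"
          then have "deg ?d F u = 0" using F gr by (intro deg_outside) (auto simp: graph_def)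
          then show False using that(2) by simp
        qed
        ultimately show ?thesis
          using that(2) \<open>\<forall>u\<in>verts G - (?X \<union> ?Q). even (deg ?d F u)\<close> by blast
      qed
      then have "{x \<in> ?U. odd (deg ?d F x)} = ?T \<inter> ?Q" by auto
      moreover have "even (card {x \<in> ?U. odd (deg ?d F x)})"
        using pX by (intro even_card_odd_component[OF gr F]) auto
      ultimately show False using False by simp
    qed
    \<comment> \<open>The reversed ear ends at \<open>p 0\<close>, which \<open>F\<close> joins to
      an inner vertex, so its last edge may be dropped.\<close>
    let ?p = "\<lambda>i. p (n - i)"
    have Q: "?p ` {0<..<n} = ?Q"
    proof
      show "?p ` {0<..<n} \<subseteq> ?Q" by auto
      show "?Q \<subseteq> ?p ` {0<..<n}"
      proof
        fix x assume "x \<in> ?Q"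
        then obtain i where "0 < i" "i < n" "x = p i" by auto
        then show "x \<in> ?p ` {0<..<n}" by (intro image_eqI[of _ _ "n - i"]) auto
      qed
    qed
    have "\<exists>F P L. covers G ?X F P L \<and> (?p 0, ?p n) \<in> (joins ?d (F \<union> P))\<^sup>*"
    proof (rule covers_close[OF gr upath_rev[OF p(1)] p(2)])
      show "p (n - 0) \<in> ?X" "p (n - n) \<in> ?X" using p by auto
      show "?p ` {0<..<n} \<subseteq> verts G - ?X" unfolding Q by (rule pX)
      show "covers G (?X \<union> ?p ` {0<..<n}) F P L" unfolding Q by (rule cov)
      show "even (card (?T \<inter> ?p ` {0<..<n})) \<or>
          (\<exists>q \<in> ?p ` {0<..<n}. (q, p (n - n)) \<in> (joins ?d F)\<^sup>*)"
        unfolding Q using \<open>p 0 \<in> ?U\<close> by auto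
    qed
    then have "\<exists>F P L. covers G ?X F P L \<and> (p n, p 0) \<in> (joins ?d (F \<union> P))\<^sup>*" by simp
    then show ?thesis using ends joins_sym by (metis doubleton_eq_iff)
  qed
  then show ?thesis using that by blast
qed

section \<open>Back to paths, linear forests and open trails as graphs\<close>

text \<open>Edges join neighbours in \<open>L\<close>, so a connected \<open>C\<close> has no gap
  between its first and last position in \<open>L\<close> and is the segment between them.
  Injectivity of \<open>ends C\<close> excludes parallel edges.\<close>

lemma path_of_along:
  assumes C: "connected C" and L: "distinct L" "verts C \<subseteq> set L"
    and al: "along (ends C) (edges C) L"
  shows "path C"
proof -
  let ?d = "ends C"
  have gr: "graph C" and "verts C \<noteq> {}" using C by (auto simp: connected_def)
  define I where "I = {i. i < length L \<and> L ! i \<in> verts C}"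
  have idx: "\<exists>i\<in>I. x = L ! i" if "x \<in> verts C" for x
    using that L(2) by (auto simp: I_def in_set_conv_nth dest!: subsetD)
  have finI: "finite I" and neI: "I \<noteq> {}" using idx \<open>verts C \<noteq> {}\<close> by (auto simp: I_def)
  define a where "a = Min I"
  define b where "b = Max I"
  have ab: "a \<in> I" "b \<in> I" and I: "\<And>i. i \<in> I \<Longrightarrow> a \<le> i \<and> i \<le> b"
    using finI neI by (auto simp: a_def b_def)
  have Leq: "L ! i = L ! j \<longleftrightarrow> i = j" if "i < length L" "j < length L" for i j
    using L(1) that by (simp add: nth_eq_iff_index_eq)
  \<comment> \<open>If no edge joins positions \<open>i\<close> and \<open>Suc i\<close>, everything
    reachable from position \<open>a\<close> stays at positions up to \<open>i\<close>, and
    \<open>b\<close> is never reached.\<close>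
  have cross: "\<exists>e\<in>edges C. ?d e = {L ! i, L ! Suc i}" if i: "a \<le> i" "i < b" for i
  proof (rule ccontr)
    assume no: "\<not> ?thesis"
    have "(L ! a, L ! b) \<in> (joins ?d (edges C))\<^sup>*"
      using ab by (intro joins_of_connected[OF C]) (auto simp: I_def)
    then have "\<exists>j\<le>i. j < length L \<and> L ! b = L ! j"
    proof (induction rule: rtrancl_induct)
      case base
      then show ?case using ab i by (auto simp: I_def)
    next
      case (step y z)
      then obtain j where j: "j \<le> i" "j < length L" "y = L ! j" by blast
      obtain e where e: "e \<in> edges C" "?d e = {y, z}" using step.hyps by (auto simp: joins_def)
      then obtain k where k: "Suc k < length L" "?d e = {L ! k, L ! Suc k}"
        using al by (auto simp: along_def)
      then have "k \<noteq> i" using no e by blast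
      have "y = L ! k \<and> z = L ! Suc k \<or> y = L ! Suc k \<and> z = L ! k"
        using e k by (auto simp: doubleton_eq_iff)
      then show ?case
      proof
        assume "y = L ! k \<and> z = L ! Suc k"
        then have "j = k" "z = L ! Suc k" using Leq[of j k] j k by auto
        then show ?thesis using j k \<open>k \<noteq> i\<close> by (intro exI[of _ "Suc k"]) auto
      next
        assume "y = L ! Suc k \<and> z = L ! k"
        then have "j = Suc k" "z = L ! k" using Leq[of j "Suc k"] j k by auto
        then show ?thesis using j k by (intro exI[of _ k]) auto
      qed
    qed
    then obtain j where "j \<le> i" "j < length L" "L ! b = L ! j" by blast
    then show False using Leq[of b j] ab i by (auto simp: I_def)
  qed
  then obtain g where g: "\<And>i. a \<le> i \<Longrightarrow> i < b \<Longrightarrow> g i \<in> edges C \<and> ?d (g i) = {L ! i, L ! Suc i}"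
    by metis
  have Iab: "i \<in> I" if "a \<le> i" "i \<le> b" for i
  proof (cases "i = b")
    case True
    then show ?thesis using ab by simp
  next
    case False
    then have "g i \<in> edges C" "?d (g i) = {L ! i, L ! Suc i}" using g[of i] that by auto
    then have "L ! i \<in> verts C" using gr by (auto simp: graph_def)
    then show ?thesis using ab that by (auto simp: I_def)
  qed
  let ?p = "\<lambda>i. L ! (a + i)" and ?f = "\<lambda>i. g (a + i)" and ?n = "b - a"
  have le: "a \<le> b" using I ab by blast
  have V: "?p ` {..?n} = verts C"
  proof
    show "?p ` {..?n} \<subseteq> verts C" using Iab le by (auto simp: I_def)
    show "verts C \<subseteq> ?p ` {..?n}"
    proof
      fix x assume "x \<in> verts C"
      then obtain i where "i \<in> I" "x = L ! i" using idx by blast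
      then show "x \<in> ?p ` {..?n}" using I[of i] by (intro image_eqI[of _ _ "i - a"]) auto
    qed
  qed
  have E: "?f ` {..<?n} = edges C"
  proof
    show "?f ` {..<?n} \<subseteq> edges C" using g by auto
    show "edges C \<subseteq> ?f ` {..<?n}"
    proof
      fix e assume e: "e \<in> edges C"
      then obtain k where k: "Suc k < length L" "?d e = {L ! k, L ! Suc k}"
        using al by (auto simp: along_def)
      moreover have "?d e \<subseteq> verts C" using gr e by (auto simp: graph_def)
      ultimately have "k \<in> I" "Suc k \<in> I" by (auto simp: I_def)
      then have kab: "a \<le> k" "k < b" using I[of k] I[of "Suc k"] by auto
      then have "e = g k" using g[of k] k e al by (auto simp: along_def inj_on_def)
      then show "e \<in> ?f ` {..<?n}" using kab by (intro image_eqI[of _ _ "k - a"]) auto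
    qed
  qed
  have "inj_on ?p {..?n}"
  proof (rule inj_onI)
    fix i j assume ij: "i \<in> {..?n}" "j \<in> {..?n}" "?p i = ?p j"
    moreover have "b < length L" using ab by (simp add: I_def)
    ultimately show "i = j" using Leq[of "a + i" "a + j"] le by auto
  qed
  moreover from this have "upath ?d (edges C) ?p ?f ?n" using g by (auto simp: upath_def)
  then have "walk C (map ?p [0..<Suc ?n]) (map ?f [0..<?n])"
    using V by (intro walk_of_upath) auto
  moreover have "{0..<Suc ?n} = {..?n}" "{0..<?n} = {..<?n}" by auto
  ultimately show ?thesis unfolding path_def using gr V E
    by (intro conjI exI[of _ "map ?p [0..<Suc ?n]"] exI[of _ "map ?f [0..<?n]"])
      (simp_all add: distinct_map del: upt_Suc)
qed

lemma linear_forest_of_along: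
  assumes "graph H" "distinct L" "verts H \<subseteq> set L" "along (ends H) (edges H) L"
  shows "linear_forest H"
  unfolding linear_forest_def
proof (intro conjI allI impI)
  fix C assume "component H C"
  then have C: "connected C" "verts C \<subseteq> verts H" "edges C \<subseteq> edges H"
    "\<forall>e\<in>edges C. ends C e = ends H e"
    by (auto simp: component_def subgraph_def)
  have "along (ends C) (edges C) L"
    using assms(4) C(3,4) unfolding along_def inj_on_def by (metis subsetD)
  then show "path C" using C assms(2,3) by (intro path_of_along[of C L]) auto
qed (rule assms(1))

lemma degree_eq_deg: "degree \<lparr>verts = W, edges = A, ends = d\<rparr> x = deg d A x"
  by (simp add: degree_def deg_def)

text \<open>Degrees along a path are 1 at both ends and 2 in between. The parity claim is what makes
  removing the path from \<open>F\<close> leave even degrees.\<close>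

lemma open_trail_of_upath:
  assumes G: "graph G" and p: "upath (ends G) (edges G) p f n" "0 < n"
  defines "J \<equiv> \<lparr>verts = p ` {..n}, edges = f ` {..<n}, ends = ends G\<rparr>"
  shows "open_trail J"
    and "\<And>x. odd (deg (ends G) (f ` {..<n}) x) \<longleftrightarrow> x \<in> {p 0, p n}"
proof -
  have inj: "inj_on p {..n}" using p by (simp add: upath_def)
  have fe: "f i \<in> edges G" "ends G (f i) = {p i, p (Suc i)}" if "i < n" for i
    using p(1) that by (auto simp: upath_def)
  then have "card (ends G (f i)) = 2 \<and> ends G (f i) \<subseteq> p ` {..n}" if "i < n" for i
    using G fe[OF that] that unfolding graph_def
    by (metis atMost_iff image_eqI insert_subset empty_subsetI less_imp_le Suc_leI)
  then have grJ: "graph J" by (auto simp: graph_def J_def)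
  have "walk J (map p [0..<Suc n]) (map f [0..<n])"
    using p by (intro walk_of_upath) (auto simp: J_def upath_def)
  moreover have "inj_on f {..<n}" using upath_inj_edges[OF p(1)] by (auto simp: inj_on_def)
  moreover have "hd (map p [0..<Suc n]) = p 0" "last (map p [0..<Suc n]) = p n"
    by (auto simp: hd_map last_map simp del: upt_Suc)
  moreover have "p 0 \<noteq> p n" using inj p(2) by (auto dest: inj_onD)
  moreover have "{0..<Suc n} = {..n}" "{0..<n} = {..<n}" by auto
  ultimately show "open_trail J" unfolding open_trail_def using grJ
    by (intro conjI exI[of _ "map p [0..<Suc n]"] exI[of _ "map f [0..<n]"])
      (simp_all add: distinct_map J_def del: upt_Suc)
  show "odd (deg (ends G) (f ` {..<n}) x) \<longleftrightarrow> x \<in> {p 0, p n}" for x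
  proof (cases "x \<in> p ` {..n}")
    case False
    then have "deg (ends G) (f ` {..<n}) x = 0"
      using p by (intro deg_outside) (auto simp: upath_def)
    then show ?thesis using False by auto
  next
    case True
    then obtain i where i: "i \<le> n" "x = p i" by auto
    have "x \<in> {p 0, p n} \<longleftrightarrow> i = 0 \<or> i = n" using i inj by (auto dest: inj_onD)
    moreover have "deg (ends G) (f ` {..<n}) x = card {j \<in> {..<n}. j = i \<or> Suc j = i}"
      using upath_deg[OF p(1), of "{..<n}" i] i by simp
    moreover have "{j \<in> {..<n}. j = i \<or> Suc j = i} =
      (if i = 0 then {0} else if i = n then {n - 1} else {i - 1, i})"
      using i p(2) by auto
    then have "card {j \<in> {..<n}. j = i \<or> Suc j = i} = (if i = 0 \<or> i = n then 1 else 2)"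
      using p(2) by (cases i) auto
    ultimately show ?thesis by simp
  qed
qed

section \<open>Assembling the EPS-graph or the JEPS-graph\<close>

theorem theorem1:
  fixes G :: "('v, 'e) mgraph" and v w :: 'v
  assumes "two_connected G"
    and "v \<in> verts G" and "w \<in> verts G" and "v \<noteq> w"
  shows "(\<exists>S E P. eps_graph G S E P \<and> degree P v = 0 \<and> degree P w = 0) \<or>
         (\<exists>S J E P. jeps_graph G S J E P \<and>
            {x \<in> verts J. odd (degree J x)} = {v, w} \<and>
            degree P v = 0 \<and> degree P w = 0)"
proof -
  let ?d = "ends G" and ?V = "verts G"
  let ?H = "\<lambda>W A. \<lparr>verts = W, edges = A, ends = ?d\<rparr>"
  have gr: "graph G" using assms by (simp add: two_connected_def)
  obtain F P L where cov: "covers G {v, w} F P L" and vw: "(v, w) \<in> (joins ?d (F \<union> P))\<^sup>*"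
    by (rule covers_pair_connected[OF assms])
  have F: "F \<subseteq> edges G" and P: "P \<subseteq> edges G" and FP: "F \<inter> P = {}"
    and ev: "\<forall>u\<in>?V - {v, w}. even (deg ?d F u)"
    and L: "distinct L" "set L = ?V - {v, w}" "along ?d P L"
    and con: "\<forall>u\<in>?V. \<exists>z\<in>{v, w}. (u, z) \<in> (joins ?d (F \<union> P))\<^sup>*"
    using cov by (auto simp: covers_def)
  have finF: "finite F" using gr F by (auto simp: graph_def intro: finite_subset)
  have sub: "subgraph (?H W A) (?H W' A')"
    if "A \<subseteq> A'" "W \<subseteq> W'" "A' \<subseteq> edges G" "W' \<subseteq> ?V"
      "\<And>e. e \<in> A \<Longrightarrow> ?d e \<subseteq> W" "\<And>e. e \<in> A' \<Longrightarrow> ?d e \<subseteq> W'" for A A' W W'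
  proof -
    have "finite W'" "finite A'" "\<forall>e\<in>A'. card (?d e) = 2"
      using gr that finite_subset[of W' ?V] finite_subset[of A' "edges G"] by (auto simp: graph_def)
    then show ?thesis
      using that finite_subset[of W W'] finite_subset[of A A'] by (auto simp: subgraph_def graph_def)
  qed
  have inV: "?d e \<subseteq> ?V" if "e \<in> edges G" for e using gr that by (simp add: graph_def)
  have Pin: "?d e \<subseteq> ?V - {v, w}" if "e \<in> P" for e
    using L that by (fastforce simp: along_def)
  \<comment> \<open>\<open>?P\<close> gets only the vertices in \<open>L\<close>, as
    \<open>linear_forest_of_along\<close> requires; the eulerian part will supply all of
    \<open>?V\<close>.\<close>
  let ?S = "?H ?V (F \<union> P)" and ?P = "?H (?V - {v, w}) P"
  have grS: "graph ?S" using gr F P by (auto simp: graph_def intro: finite_subset)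
  \<comment> \<open>Every vertex reaches \<open>v\<close> or \<open>w\<close>, and these are joined,
    so \<open>v\<close> serves as a hub.\<close>
  have "(u, v) \<in> (joins ?d (F \<union> P))\<^sup>*" if "u \<in> ?V" for u
  proof -
    obtain z where "z \<in> {v, w}" "(u, z) \<in> (joins ?d (F \<union> P))\<^sup>*" using con \<open>u \<in> ?V\<close> by metis
    then show ?thesis using joins_sym[OF vw] rtrancl_trans[of u z _ v] by auto
  qed
  then have "(u, x) \<in> (joins ?d (F \<union> P))\<^sup>*" if "u \<in> ?V" "x \<in> ?V" for u x
    using that joins_sym[of x v] rtrancl_trans[of u v _ x] by blast
  then have "connected ?S" using assms(2) by (intro connectedI[OF grS]) auto
  moreover have "subgraph ?S G"
    using grS gr F P by (auto simp: subgraph_def)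
  ultimately have S: "spanning_connected_subgraph ?S G"
    by (simp add: spanning_connected_subgraph_def)
  have PS: "subgraph ?P ?S" using F P inV Pin by (intro sub) auto
  then have "graph ?P" by (simp add: subgraph_def)
  then have PL: "linear_forest ?P" using L by (intro linear_forest_of_along[of _ L]) auto
  have "deg ?d P v = 0" "deg ?d P w = 0" using Pin by (auto intro!: deg_outside)
  then have P0: "degree ?P v = 0" "degree ?P w = 0" by (simp_all add: degree_eq_deg)
  have ES: "subgraph (?H ?V A) ?S" if "A \<subseteq> F" for A
  proof (rule sub)
    show "F \<union> P \<subseteq> edges G" using F P by blast
    show "?d e \<subseteq> ?V" if "e \<in> A" for e using that \<open>A \<subseteq> F\<close> F inV by blast
    show "?d e \<subseteq> ?V" if "e \<in> F \<union> P" for e using that F P inV by blast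
  qed (use that in auto)
  have euler: "eulerian (?H ?V A)" if "A \<subseteq> F" "\<forall>x\<in>?V. even (deg ?d A x)" for A
    using that ES[OF that(1)] by (simp add: eulerian_def subgraph_def degree_eq_deg)
  show ?thesis
  proof (cases "even (deg ?d F v) \<and> even (deg ?d F w)")
    case True
    then have "\<forall>x\<in>?V. even (deg ?d F x)" using ev by blast
    then have "eps_graph G ?S (?H ?V F) ?P"
      using S ES[of F] PS euler[of F] PL FP by (auto simp: eps_graph_def)
    then show ?thesis using P0 by blast
  next
    case False
    have odd: "odd (deg ?d F v) \<and> odd (deg ?d F w)" "(v, w) \<in> (joins ?d F)\<^sup>*"
    proof -
      \<comment> \<open>In the component of \<open>a\<close> in \<open>F\<close> only
        \<open>a\<close> and \<open>b\<close> can have odd degree, so by the handshake lemma an odd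
        \<open>a\<close> forces an odd \<open>b\<close> in the same component. The symmetric form
        serves whichever of \<open>v\<close> and \<open>w\<close> is known to be odd.\<close>
      have conF: "odd (deg ?d F b) \<and> (a, b) \<in> (joins ?d F)\<^sup>*"
        if ab: "{a, b} = {v, w}" and "odd (deg ?d F a)" for a b
      proof (rule ccontr)
        assume no: "\<not> ?thesis"
        let ?U = "{x \<in> (joins ?d F)\<^sup>* `` {a}. odd (deg ?d F x)}"
        have "x = a" if "x \<in> ?U" for x
        proof -
          have "x \<in> ?V"
          proof (rule ccontr)
            assume "x \<notin> ?V"
            then have "deg ?d F x = 0" using F inV by (intro deg_outside) blast
            then show False using that by simp
          qed
          then have "x \<in> {a, b}" using that ev ab by auto
          then show ?thesis using that no by auto
        qed
        then have "?U = {a}" using \<open>odd (deg ?d F a)\<close> by auto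
        moreover have "{a} \<subseteq> ?V" using ab assms(2,3) by auto
        then have "even (card ?U)" by (rule even_card_odd_component[OF gr F])
        ultimately show False by simp
      qed
      have "odd (deg ?d F v) \<and> odd (deg ?d F w) \<and> (v, w) \<in> (joins ?d F)\<^sup>*"
      proof (cases "odd (deg ?d F v)")
        case True
        then show ?thesis using conF[of v w] by blast
      next
        case no: False
        then show ?thesis using False conF[of w v] by blast
      qed
      then show "odd (deg ?d F v) \<and> odd (deg ?d F w)" "(v, w) \<in> (joins ?d F)\<^sup>*" by blast+
    qed
    obtain n p f where p: "upath ?d F p f n" "p 0 = v" "p n = w"
      by (rule upath_of_joins[OF odd(2)])
    have n: "0 < n" using p assms(4) by (cases n) auto
    have pG: "upath ?d (edges G) p f n" using p(1) F by (auto simp: upath_def)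
    let ?A = "f ` {..<n}"
    let ?J = "?H (p ` {..n}) ?A"
    have AF: "?A \<subseteq> F" using p by (auto simp: upath_def)
    have J: "open_trail ?J" and oddJ: "\<And>x. odd (deg ?d ?A x) \<longleftrightarrow> x \<in> {v, w}"
      using open_trail_of_upath[OF gr pG n] p by auto
    have pV: "p ` {..n} \<subseteq> ?V"
    proof
      fix x assume "x \<in> p ` {..n}"
      then obtain i where i: "i \<le> n" "x = p i" by auto
      show "x \<in> ?V"
      proof (cases "i = n")
        case False
        then have "f i \<in> edges G" "x \<in> ?d (f i)" using i pG by (auto simp: upath_def)
        then show ?thesis using inV by blast
      qed (use i p assms in auto)
    qed
    have "?d e \<subseteq> p ` {..n}" if "e \<in> ?A" for e using that p(1) by (auto simp: upath_def)
    moreover have "?d e \<subseteq> ?V" if "e \<in> F \<union> P" for e using that F P inV by blast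
    ultimately have JS: "subgraph ?J ?S" by (intro sub) (use AF F P pV in auto)
    \<comment> \<open>\<open>F\<close> and the path \<open>?A\<close> both have exactly
      \<open>v\<close> and \<open>w\<close> as odd vertices, so the parities cancel.\<close>
    have "even (deg ?d (F - ?A) x)" if "x \<in> ?V" for x
    proof -
      have "F = ?A \<union> (F - ?A)" using AF by auto
      then have "deg ?d F x = deg ?d ?A x + deg ?d (F - ?A) x"
        using finF deg_Un[of ?A "F - ?A" ?d x] by auto
      moreover have "odd (deg ?d F x) \<longleftrightarrow> x \<in> {v, w}" using ev odd(1) that by auto
      ultimately show ?thesis using oddJ[of x] by auto
    qed
    then have "eulerian (?H ?V (F - ?A))" by (intro euler) auto
    then have "jeps_graph G ?S ?J (?H ?V (F - ?A)) ?P"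
      using S JS ES[of "F - ?A"] PS J PL FP AF pV by (auto simp: jeps_graph_def)
    moreover have "{x \<in> verts ?J. odd (degree ?J x)} = {v, w}"
      unfolding degree_eq_deg oddJ using p by force
    ultimately show ?thesis using P0 by blast
  qed
qed

end
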